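(* Let $\nu\ge 1$, $s\ge 1$, $t\ge 0$ be integers and let $\bm{t}=(t_1,\dots,t_s)$ be a sequence of non-negative integers with $t_1+\cdots+t_s=t$. Then for all integers $n\ge 0$ and $k\ge 0$, the number of $(\nu,\bm{t},n)$-Stirling permutations with exactly $k$ ascents is equal to the $\nu$-order $(s,t)$-Eulerian number $E^{(\nu)}_{(s,t)}(n,k)$.
   Context: Write $[n]=\{1,\dots,n\}$ (with $[0]=\emptyset$). For integers $\nu\ge1$, $t\ge0$ and a finite set $X=\{x_1<\dots<x_m\}$ of positive integers, put $x_0=0$. A $(\nu,t,X)$-Stirling permutation is a permutation (arrangement as a word) of the multiset $\{0^t,x_1^\nu,\dots,x_m^\nu\}$ (i.e. $0$ occurs $t$ times and each $x_i$ occurs $\nu$ times) such that for each $0\le j\le m$ the elements occurring between two occurrences of $x_j$ are all at least $x_j$. If $X=\emptyset$, the unique such permutation is $0^t$ (the empty word if $t=0$). For $\bm{t}=(t_1,\dots,t_s)$ with $t_i\ge0$, a $(\nu,\bm{t},n)$-Stirling permutation is a sequence $(\rho_1,\dots,\rho_s)$ such that, for some ordered partition $(X_1,\dots,X_s)$ of $[n]$ into pairwise disjoint, possibly empty, subsets with union $[n]$, each $\rho_i$ is a $(\nu,t_i,X_i)$-Stirling permutation. An ascent of a word $r_1r_2\cdots r_m$ is an index $i$ with $1\le i<m$ and $r_i<r_{i+1}$. The number of ascents of a sequence $(\rho_1,\dots,\rho_s)$ is the sum of the numbers of ascents of its entries $\rho_i$. The $\nu$-order $(s,t)$-Eulerian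 numbers $E^{(\nu)}_{(s,t)}(n,k)$ are defined by $$E^{(\nu)}_{(s,t)}(n,k)=(k+s)\,E^{(\nu)}_{(s,t)}(n-1,k)+(\nu n-k+t+1-\nu)\,E^{(\nu)}_{(s,t)}(n-1,k-1)+\delta_{k0}\delta_{n0},$$ with $E^{(\nu)}_{(s,t)}(n,k)=0$ if $n<0$ or $k<0$. *)

theory Defs
  imports Main "HOL-Library.Multiset"
begin

text \<open>Words are lists of natural numbers. The set \<open>X\<close> is meant to be a finite set of positive
  integers; the letter \<open>0\<close> plays the role of \<open>x\<^sub>0\<close>.\<close>

definition stirling_perm :: "nat \<Rightarrow> nat \<Rightarrow> nat set \<Rightarrow> nat list \<Rightarrow> bool" where
  "stirling_perm \<nu> t X w \<longleftrightarrow>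
     mset w = replicate_mset t 0 + (\<Sum>x\<in>X. replicate_mset \<nu> x) \<and>
     (\<forall>x \<in> insert 0 X. \<forall>i j l. i < j \<and> j < l \<and> l < length w \<and> w ! i = x \<and> w ! l = x
        \<longrightarrow> x \<le> w ! j)"

definition ordered_partition :: "nat set list \<Rightarrow> nat set \<Rightarrow> bool" where
  "ordered_partition Xs A \<longleftrightarrow>
     \<Union> (set Xs) = A \<and>
     (\<forall>i < length Xs. \<forall>j < length Xs. i \<noteq> j \<longrightarrow> Xs ! i \<inter> Xs ! j = {})"

definition stirling_perm_seq :: "nat \<Rightarrow> nat list \<Rightarrow> nat \<Rightarrow> nat list list \<Rightarrow> bool" where
  "stirling_perm_seq \<nu> ts n \<rho>s \<longleftrightarrow>
     length \<rho>s = length ts \<and>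
     (\<exists>Xs. length Xs = length ts \<and> ordered_partition Xs {1..n} \<and>
        (\<forall>i < length ts. stirling_perm \<nu> (ts ! i) (Xs ! i) (\<rho>s ! i)))"

text \<open>Positions are counted from \<open>0\<close>, which does not affect the number of ascents.\<close>

definition ascents :: "nat list \<Rightarrow> nat" where
  "ascents w = card {i. Suc i < length w \<and> w ! i < w ! Suc i}"

definition ascents_seq :: "nat list list \<Rightarrow> nat" where
  "ascents_seq \<rho>s = (\<Sum>\<rho>\<leftarrow>\<rho>s. ascents \<rho>)"

text \<open>The arguments \<open>n\<close>, \<open>k\<close> and the values are integers: the recurrence refers to negative
  indices, and its second coefficient can be negative.\<close>

function eulerian :: "nat \<Rightarrow> nat \<Rightarrow> nat \<Rightarrow> int \<Rightarrow> int \<Rightarrow> int" where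
  "eulerian \<nu> s t n k =
     (if n < 0 \<or> k < 0 then 0
      else (k + int s) * eulerian \<nu> s t (n - 1) k
         + (int \<nu> * n - k + int t + 1 - int \<nu>) * eulerian \<nu> s t (n - 1) (k - 1)
         + (if k = 0 \<and> n = 0 then 1 else 0))"
  by pat_completeness auto
termination
  by (relation "measure (\<lambda>(_, _, _, n, _). nat (n + 1))") auto

declare eulerian.simps [simp del]

end

theory Submission
  imports Defs "HOL-Library.Sublist"
begin

text \<open>In a sequence of Stirling permutations on \<open>{1..n + 1}\<close> the \<open>\<nu>\<close> copies of the largest letter
  \<open>n + 1\<close> lie in one word and are adjacent there, because any other letter between two of them would
  be smaller. Deleting this block leaves a sequence on \<open>{1..n}\<close>, and conversely the block may be
  put back into any gap of any of the \<open>s\<close> words. So sequences at level \<open>n + 1\<close> correspond bijectively to pairs of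
  a sequence at level \<open>n\<close> and a gap in it (\<open>stirling_perm_seqs_Suc\<close>, \<open>inj_on_insert_block_seq\<close>).

  The effect on ascents depends only on the gap. A block at the front of a word, or inside an
  existing ascent, leaves the number of ascents unchanged; in every other gap it creates exactly
  one new ascent. A sequence with \<open>k\<close> ascents has \<open>k + s\<close> gaps of the first kind. Its total length
  is \<open>\<nu> * n + t\<close>, so it has \<open>\<nu> * n + t + s\<close> gaps altogether and \<open>\<nu> * n + t - k\<close> of the second kind.
  Counting the sequences at level \<open>n + 1\<close> by the number of ascents of their reduction yields the
  recurrence of the Eulerian numbers (\<open>card_stirling_perm_seqs_Suc\<close>).\<close>

section \<open>Stirling words as pattern-avoiding words\<close>

text \<open>The nesting condition is avoidance of the pattern 212. Phrasing it by subsequences makes it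
  evidently hereditary, so deleting letters preserves it.\<close>

definition avoids_212 :: "nat list \<Rightarrow> bool" where
  "avoids_212 w \<longleftrightarrow> (\<forall>x y. y < x \<longrightarrow> \<not> subseq [x, y, x] w)"

lemma avoids_212_subseq: "avoids_212 w \<Longrightarrow> subseq w' w \<Longrightarrow> avoids_212 w'"
  unfolding avoids_212_def by (meson subseq_order.trans)

lemma subseq_imp_subset: "subseq xs ys \<Longrightarrow> set xs \<subseteq> set ys"
  by (auto elim: list_emb_set)

lemma subseq_triple_iff_nth:
  "subseq [a, b, c] w \<longleftrightarrow> (\<exists>i j l. i < j \<and> j < l \<and> l < length w \<and> w ! i = a \<and> w ! j = b \<and> w ! l = c)"
proof
  assume "subseq [a, b, c] w"
  then obtain u1 v1 where 1: "w = u1 @ a # v1" "subseq [b, c] v1"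
    by (blast dest: list_emb_ConsD)
  then obtain u2 v2 where 2: "v1 = u2 @ b # v2" "subseq [c] v2"
    by (blast dest: list_emb_ConsD)
  then obtain u3 v3 where 3: "v2 = u3 @ c # v3"
    by (blast dest: list_emb_ConsD)
  have w: "w = u1 @ a # u2 @ b # u3 @ c # v3"
    using 1 2 3 by simp
  show "\<exists>i j l. i < j \<and> j < l \<and> l < length w \<and> w ! i = a \<and> w ! j = b \<and> w ! l = c"
    by (rule exI[of _ "length u1"], rule exI[of _ "length (u1 @ a # u2)"],
        rule exI[of _ "length (u1 @ a # u2 @ b # u3)"]) (simp add: w nth_append)
next
  assume "\<exists>i j l. i < j \<and> j < l \<and> l < length w \<and> w ! i = a \<and> w ! j = b \<and> w ! l = c"
  then obtain i j l where ijl: "i < j" "j < l" "l < length w" "w ! i = a" "w ! j = b" "w ! l = c"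
    by blast
  have "subseq [c] (drop (Suc j) w)"
    using ijl by (auto simp: subseq_singleton_left in_set_conv_nth intro!: exI[of _ "l - Suc j"])
  then have "subseq [b, c] (drop j w)"
    using ijl by (metis Cons_nth_drop_Suc order.strict_trans subseq_Cons2)
  moreover have "subseq (drop j w) (drop (Suc i) w)"
    using ijl by (metis Suc_leI drop_drop le_add_diff_inverse2 suffix_drop suffix_imp_subseq)
  ultimately have "subseq [b, c] (drop (Suc i) w)"
    by (rule subseq_order.trans)
  then have "subseq [a, b, c] (drop i w)"
    using ijl by (metis Cons_nth_drop_Suc order.strict_trans subseq_Cons2)
  then show "subseq [a, b, c] w"
    by (meson subseq_order.trans suffix_drop suffix_imp_subseq)
qed

lemma set_mset_multiples:
  assumes "finite X"
  shows "set_mset (\<Sum>x\<in>X. replicate_mset \<nu> x) \<subseteq> X"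
  using assms by (induction X rule: finite_induct) (auto split: if_splits)

lemma set_stirling_multiset:
  assumes "mset w = replicate_mset t 0 + (\<Sum>x\<in>X. replicate_mset \<nu> x)" "finite X"
  shows "set w \<subseteq> insert 0 X"
proof -
  have "set w = set_mset (replicate_mset t 0) \<union> set_mset (\<Sum>x\<in>X. replicate_mset \<nu> x)"
    using assms(1) by (metis set_mset_mset set_mset_union)
  also have "\<dots> \<subseteq> {0} \<union> X"
    using set_mset_multiples[OF assms(2)] by (intro Un_mono) (simp_all split: if_splits)
  finally show ?thesis
    by simp
qed

lemma stirling_perm_set:
  assumes "stirling_perm \<nu> t X w" "finite X"
  shows "set w \<subseteq> insert 0 X"
  using assms set_stirling_multiset unfolding stirling_perm_def by blast

lemma stirling_perm_iff_avoids:
  assumes "finite X"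
  shows "stirling_perm \<nu> t X w \<longleftrightarrow>
    mset w = replicate_mset t 0 + (\<Sum>x\<in>X. replicate_mset \<nu> x) \<and> avoids_212 w"
proof (cases "mset w = replicate_mset t 0 + (\<Sum>x\<in>X. replicate_mset \<nu> x)")
  case True
  \<comment> \<open>All letters lie in \<open>insert 0 X\<close>, so the restriction of \<open>x\<close> to this set excludes no pattern.\<close>
  then have letter: "w ! i \<in> insert 0 X" if "i < length w" for i
    using that nth_mem set_stirling_multiset[OF _ assms] by blast
  have "(\<forall>x \<in> insert 0 X. \<forall>i j l. i < j \<and> j < l \<and> l < length w \<and> w ! i = x \<and> w ! l = x
        \<longrightarrow> x \<le> w ! j) \<longleftrightarrow> avoids_212 w"
    unfolding avoids_212_def subseq_triple_iff_nth
    by (metis letter linorder_not_less)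
  then show ?thesis
    using True unfolding stirling_perm_def by blast
qed (simp add: stirling_perm_def)

section \<open>Inserting and removing the block of largest letters\<close>

definition insert_block :: "nat \<Rightarrow> nat \<Rightarrow> nat \<Rightarrow> nat list \<Rightarrow> nat list" where
  "insert_block \<nu> m p w = take p w @ replicate \<nu> m @ drop p w"

lemma mset_insert_block: "mset (insert_block \<nu> m p w) = mset w + replicate_mset \<nu> m"
proof -
  have "mset w = mset (take p w) + mset (drop p w)"
    by (metis append_take_drop_id mset_append)
  then show ?thesis
    by (simp add: insert_block_def)
qed

lemma length_insert_block: "length (insert_block \<nu> m p w) = length w + \<nu>"
  by (metis mset_insert_block size_mset size_replicate_mset size_union)

lemma filter_insert_block:
  assumes "m \<notin> set w"
  shows "filter (\<lambda>x. x \<noteq> m) (insert_block \<nu> m p w) = w"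
proof -
  have "filter (\<lambda>x. x \<noteq> m) (insert_block \<nu> m p w)
      = filter (\<lambda>x. x \<noteq> m) (take p w @ drop p w)"
    by (simp add: insert_block_def del: append_take_drop_id)
  also have "\<dots> = w"
    unfolding append_take_drop_id using assms by (auto simp: filter_id_conv)
  finally show ?thesis .
qed

lemma takeWhile_insert_block:
  assumes "m \<notin> set w" "\<nu> \<ge> 1"
  shows "takeWhile (\<lambda>x. x \<noteq> m) (insert_block \<nu> m p w) = take p w"
proof -
  obtain \<mu> where "\<nu> = Suc \<mu>"
    using assms(2) by (cases \<nu>) auto
  moreover have "\<forall>x \<in> set (take p w). x \<noteq> m"
    using assms(1) by (auto dest: in_set_takeD)
  ultimately show ?thesis
    by (simp add: insert_block_def takeWhile_append2)
qed

text \<open>The block itself cannot take part in a forbidden pattern \<open>x y x\<close>: its letter is too large to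
  be \<open>y\<close>, and as \<open>x\<close> it would force a letter \<open>y\<close> between two copies of \<open>m\<close>.\<close>

lemma avoids_212_insert_block:
  assumes "avoids_212 w" and less: "\<forall>x \<in> set w. x < m"
  shows "avoids_212 (insert_block \<nu> m p w)"
  unfolding avoids_212_def
proof (intro allI impI notI)
  fix x y :: nat
  assume yx: "y < x" and sub: "subseq [x, y, x] (insert_block \<nu> m p w)"
  have m: "m \<notin> set w"
    using less by blast
  have "set [x, y, x] \<subseteq> set (insert_block \<nu> m p w)"
    using sub by (rule subseq_imp_subset)
  also have "\<dots> \<subseteq> insert m (set w)"
    by (auto simp: insert_block_def dest: in_set_takeD in_set_dropD)
  finally have x: "x = m \<or> x < m"
    using less by auto
  show False
  proof (cases "x = m")
    case False
    then have "subseq (filter (\<lambda>x. x \<noteq> m) [x, y, x]) (filter (\<lambda>x. x \<noteq> m) (insert_block \<nu> m p w))"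
      using sub by (rule_tac subseq_filter)
    then have "subseq [x, y, x] w"
      using False x yx by (simp add: filter_insert_block[OF m])
    then show False
      using assms(1) yx unfolding avoids_212_def by blast
  next
    case True
    \<comment> \<open>The first \<open>m\<close> of the pattern is in the block, and then \<open>y\<close> and the last \<open>m\<close> come after it.\<close>
    have "\<not> subseq [m, y, m] (u @ replicate \<nu> m @ v)" if "m \<notin> set u" "m \<notin> set v" for u v
    proof
      have tail: "\<not> subseq [y, m] (replicate k m @ v)" for k
      proof (induction k)
        case 0
        show ?case
          using that(2) by (auto dest: subseq_imp_subset)
      next
        case (Suc k)
        then show ?case
          using yx True by simp
      qed
      assume "subseq [m, y, m] (u @ replicate \<nu> m @ v)"
      then have "subseq [m, y, m] (replicate \<nu> m @ v)"
        using that(1) by (induction u) auto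
      then show False
        using tail that(2) by (cases \<nu>) (auto dest: subseq_imp_subset)
    qed
    then show False
      using sub True m unfolding insert_block_def by (meson in_set_dropD in_set_takeD)
  qed
qed

text \<open>The first block of copies of \<open>m\<close> is the only one: if the word continues after it, then with
  a letter \<open>y < m\<close>, and a later copy of \<open>m\<close> would complete the pattern \<open>m y m\<close>.\<close>

lemma avoids_212_max_block:
  assumes "avoids_212 w" and le: "\<forall>x \<in> set w. x \<le> m"
  obtains u v where "w = u @ replicate (count (mset w) m) m @ v" "m \<notin> set u" "m \<notin> set v"
proof (cases "m \<in> set w")
  case False
  then have "count (mset w) m = 0"
    by (simp add: count_eq_zero_iff)
  then show ?thesis
    using False that[of w "[]"] by simp
next
  case True
  then obtain u r where w: "w = u @ m # r" and u: "m \<notin> set u"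
    by (meson split_list_first)
  define v where "v = dropWhile (\<lambda>x. x = m) r"
  have "\<forall>x \<in> set (takeWhile (\<lambda>x. x = m) r). x = m"
    by (auto dest: set_takeWhileD)
  then have "takeWhile (\<lambda>x. x = m) r = replicate (length (takeWhile (\<lambda>x. x = m) r)) m"
    by (simp add: replicate_length_same)
  then obtain k where r: "r = replicate k m @ v"
    unfolding v_def by (metis takeWhile_dropWhile_id)
  have v: "m \<notin> set v"
  proof
    assume "m \<in> set v"
    then obtain y v' where yv: "v = y # v'" "y \<noteq> m" "m \<in> set v'"
      unfolding v_def by (metis (full_types) hd_dropWhile list.exhaust_sel list.set_sel(1)
          empty_iff list.set(1) set_ConsD)
    then have "y < m"
      using le w r by auto
    moreover have "subseq [m, y, m] w"
    proof -
      have "subseq [y, m] v"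
        using yv by (simp add: subseq_singleton_left)
      then have "subseq [y, m] r"
        by (simp add: r list_emb_append2)
      then show ?thesis
        by (simp add: w list_emb_append2)
    qed
    ultimately show False
      using assms(1) unfolding avoids_212_def by blast
  qed
  have "count (mset w) m = Suc k"
    using u v by (simp add: w r count_eq_zero_iff)
  then show ?thesis
    using that[of u v] u v w r by simp
qed

lemma stirling_perm_insert_block:
  assumes "stirling_perm \<nu> t X w" "finite X" "\<forall>x \<in> X. x < m" "0 < m"
  shows "stirling_perm \<nu> t (insert m X) (insert_block \<nu> m p w)"
proof -
  have "m \<notin> X"
    using assms(3) by blast
  moreover have "\<forall>x \<in> set w. x < m"
    using stirling_perm_set[OF assms(1,2)] assms(3,4) by auto
  ultimately show ?thesis
    using assms(1,2) avoids_212_insert_block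
    by (simp add: stirling_perm_iff_avoids mset_insert_block)
qed

lemma stirling_perm_remove_block:
  assumes "stirling_perm \<nu> t X w" "finite X" "\<forall>x \<in> X. x \<le> m" "m \<in> X" "0 < m"
  obtains w' p where "w = insert_block \<nu> m p w'" "p \<le> length w'" "stirling_perm \<nu> t (X - {m}) w'"
proof -
  have mset: "mset w = replicate_mset t 0 + (\<Sum>x\<in>X. replicate_mset \<nu> x)" and av: "avoids_212 w"
    using assms(1,2) by (simp_all add: stirling_perm_iff_avoids)
  have split: "(\<Sum>x\<in>X. replicate_mset \<nu> x)
      = replicate_mset \<nu> m + (\<Sum>x\<in>X - {m}. replicate_mset \<nu> x)"
    using assms(2,4) by (simp add: sum.remove)
  have "m \<notin># (\<Sum>x\<in>X - {m}. replicate_mset \<nu> x)"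
    using set_mset_multiples[of "X - {m}" \<nu>] assms(2) by auto
  then have count: "count (mset w) m = \<nu>"
    using assms(5) by (simp add: mset split count_eq_zero_iff)
  have "\<forall>x \<in> set w. x \<le> m"
    using stirling_perm_set[OF assms(1,2)] assms(3) by auto
  then obtain u v where w: "w = u @ replicate \<nu> m @ v"
    using avoids_212_max_block[OF av, of m] count by metis
  then have w': "w = insert_block \<nu> m (length u) (u @ v)"
    by (simp add: insert_block_def)
  have "subseq (u @ v) w"
    by (simp add: w list_emb_append2 list_emb_append_mono)
  then have "avoids_212 (u @ v)"
    using av avoids_212_subseq by blast
  moreover have "mset (u @ v) = replicate_mset t 0 + (\<Sum>x\<in>X - {m}. replicate_mset \<nu> x)"
    using mset w by (simp add: split ac_simps)
  ultimately have "stirling_perm \<nu> t (X - {m}) (u @ v)"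
    using assms(2) by (simp add: stirling_perm_iff_avoids)
  then show ?thesis
    using that w' by simp
qed

section \<open>The bijection between sequences and gaps\<close>

definition insert_block_seq :: "nat \<Rightarrow> nat \<Rightarrow> nat \<times> nat \<Rightarrow> nat list list \<Rightarrow> nat list list" where
  "insert_block_seq \<nu> m g \<rho>s = \<rho>s[fst g := insert_block \<nu> m (snd g) (\<rho>s ! fst g)]"

text \<open>The gap \<open>(i, p)\<close> of the \<open>i\<close>-th word lies before its \<open>p\<close>-th letter. The bound on \<open>p\<close> is
  inclusive so as to count the gap at the end; an empty word has one gap.\<close>

definition gaps :: "nat list list \<Rightarrow> (nat \<times> nat) set" where
  "gaps \<rho>s = (SIGMA i:{..<length \<rho>s}. {..length (\<rho>s ! i)})"

abbreviation stirling_perm_seqs :: "nat \<Rightarrow> nat list \<Rightarrow> nat \<Rightarrow> nat list list set" where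
  "stirling_perm_seqs \<nu> ts n \<equiv> {\<rho>s. stirling_perm_seq \<nu> ts n \<rho>s}"

text \<open>Pointwise form of disjointness and covering, in which moving a single element in or out of a
  part is easy to follow.\<close>

lemma ordered_partition_iff:
  "ordered_partition Xs A \<longleftrightarrow>
    (\<forall>i < length Xs. Xs ! i \<subseteq> A) \<and> (\<forall>x \<in> A. \<exists>!i. i < length Xs \<and> x \<in> Xs ! i)"
  (is "?L \<longleftrightarrow> ?R")
proof -
  have Union: "\<Union> (set Xs) = {x. \<exists>i < length Xs. x \<in> Xs ! i}"
    by (fastforce simp: in_set_conv_nth)
  show ?thesis
  proof
    assume ?L
    then have A: "{x. \<exists>i < length Xs. x \<in> Xs ! i} = A"
      and disj: "\<And>i j. i < length Xs \<Longrightarrow> j < length Xs \<Longrightarrow> i \<noteq> j \<Longrightarrow> Xs ! i \<inter> Xs ! j = {}"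
      unfolding ordered_partition_def Union by auto
    have "\<exists>!i. i < length Xs \<and> x \<in> Xs ! i" if "x \<in> A" for x
      using that disj unfolding A[symmetric] by blast
    then show ?R
      using A by blast
  next
    assume R: ?R
    then have "{x. \<exists>i < length Xs. x \<in> Xs ! i} = A"
      by blast
    moreover have "Xs ! i \<inter> Xs ! j = {}" if "i < length Xs" "j < length Xs" "i \<noteq> j" for i j
      using R that by blast
    ultimately show ?L
      unfolding ordered_partition_def Union by blast
  qed
qed

lemma ordered_partition_insert:
  assumes "ordered_partition Xs A" "i < length Xs" "m \<notin> A"
  shows "ordered_partition (Xs[i := insert m (Xs ! i)]) (insert m A)"
proof -
  let ?Y = "Xs[i := insert m (Xs ! i)]"
  have sub: "\<And>j. j < length Xs \<Longrightarrow> Xs ! j \<subseteq> A"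
    and ex1: "\<And>x. x \<in> A \<Longrightarrow> \<exists>!j. j < length Xs \<and> x \<in> Xs ! j"
    using assms(1) unfolding ordered_partition_iff by auto
  have mem: "x \<in> ?Y ! j \<longleftrightarrow> x \<in> Xs ! j \<or> x = m \<and> j = i" if "j < length Xs" for x j
    using that assms(2) by (auto simp: nth_list_update)
  have "\<exists>!j. j < length ?Y \<and> x \<in> ?Y ! j" if "x \<in> insert m A" for x
  proof (cases "x = m")
    case True
    then show ?thesis
      using mem assms(2,3) sub by (intro ex1I[of _ i]) auto
  next
    case False
    then show ?thesis
      using that mem ex1[of x] by (simp cong: conj_cong)
  qed
  moreover have "?Y ! j \<subseteq> insert m A" if "j < length ?Y" for j
    using that mem sub by auto
  ultimately show ?thesis
    unfolding ordered_partition_iff by blast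
qed

lemma ordered_partition_remove:
  assumes "ordered_partition Xs A" "i < length Xs" "m \<in> Xs ! i"
  shows "ordered_partition (Xs[i := Xs ! i - {m}]) (A - {m})"
proof -
  let ?Y = "Xs[i := Xs ! i - {m}]"
  have sub: "\<And>j. j < length Xs \<Longrightarrow> Xs ! j \<subseteq> A"
    and ex1: "\<And>x. x \<in> A \<Longrightarrow> \<exists>!j. j < length Xs \<and> x \<in> Xs ! j"
    using assms(1) unfolding ordered_partition_iff by auto
  have "m \<in> A"
    using sub assms(2,3) by blast
  then have only: "j = i" if "j < length Xs" "m \<in> Xs ! j" for j
    using that ex1 assms(2,3) by blast
  have mem: "x \<in> ?Y ! j \<longleftrightarrow> x \<in> Xs ! j \<and> x \<noteq> m" if "j < length Xs" for x j
    using that only assms(2) by (auto simp: nth_list_update)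
  have "\<exists>!j. j < length ?Y \<and> x \<in> ?Y ! j" if "x \<in> A - {m}" for x
    using that mem ex1[of x] by (simp cong: conj_cong)
  moreover have "?Y ! j \<subseteq> A - {m}" if "j < length ?Y" for j
    using that mem sub by auto
  ultimately show ?thesis
    unfolding ordered_partition_iff by blast
qed

lemma stirling_perm_seqs_0:
  "stirling_perm_seqs \<nu> ts 0 = {map (\<lambda>t. replicate t 0) ts}"
proof -
  have empty: "stirling_perm \<nu> t {} w \<longleftrightarrow> w = replicate t 0" for t w
  proof
    assume "stirling_perm \<nu> t {} w"
    then have "mset w = mset (replicate t 0)"
      by (simp add: stirling_perm_def)
    then show "w = replicate t 0"
      by (metis mset_eq_length length_replicate mset_eq_setD in_set_replicate replicate_length_same)
  qed (simp add: stirling_perm_def)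
  have "stirling_perm_seq \<nu> ts 0 \<rho>s \<longleftrightarrow> \<rho>s = map (\<lambda>t. replicate t 0) ts" for \<rho>s
  proof
    assume "stirling_perm_seq \<nu> ts 0 \<rho>s"
    then show "\<rho>s = map (\<lambda>t. replicate t 0) ts"
      unfolding stirling_perm_seq_def ordered_partition_iff
      by (auto simp: list_eq_iff_nth_eq[of \<rho>s] empty[symmetric])
  next
    assume *: "\<rho>s = map (\<lambda>t. replicate t 0) ts"
    show "stirling_perm_seq \<nu> ts 0 \<rho>s"
      unfolding stirling_perm_seq_def ordered_partition_iff
      by (auto simp: * empty intro!: exI[of _ "replicate (length ts) {}"])
  qed
  then show ?thesis
    by auto
qed

lemma stirling_perm_seqs_Suc:
  "stirling_perm_seqs \<nu> ts (Suc n) =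
    (\<lambda>(\<rho>s, g). insert_block_seq \<nu> (Suc n) g \<rho>s) ` (SIGMA \<rho>s:stirling_perm_seqs \<nu> ts n. gaps \<rho>s)"
proof (intro subset_antisym subsetI)
  fix \<sigma>s assume "\<sigma>s \<in> stirling_perm_seqs \<nu> ts (Suc n)"
  then obtain Xs where len: "length \<sigma>s = length ts" "length Xs = length ts"
    and part: "ordered_partition Xs {1..Suc n}"
    and stir: "\<And>i. i < length ts \<Longrightarrow> stirling_perm \<nu> (ts ! i) (Xs ! i) (\<sigma>s ! i)"
    unfolding stirling_perm_seq_def by auto
  obtain i where i: "i < length ts" "Suc n \<in> Xs ! i"
    using part len unfolding ordered_partition_iff
    by (metis atLeastAtMost_iff le_add1 order_refl plus_1_eq_Suc)
  have X: "Xs ! i \<subseteq> {1..Suc n}"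
    using part i len unfolding ordered_partition_iff by simp
  then have "finite (Xs ! i)" "\<forall>x \<in> Xs ! i. x \<le> Suc n"
    by (auto intro: finite_subset)
  then obtain w p where w: "\<sigma>s ! i = insert_block \<nu> (Suc n) p w" "p \<le> length w"
      "stirling_perm \<nu> (ts ! i) (Xs ! i - {Suc n}) w"
    using stirling_perm_remove_block[OF stir[OF i(1)]] i(2) by blast
  have "ordered_partition (Xs[i := Xs ! i - {Suc n}]) ({1..Suc n} - {Suc n})"
    using part i len by (simp add: ordered_partition_remove)
  moreover have "{1..Suc n} - {Suc n} = {1..n}"
    by auto
  ultimately have "stirling_perm_seq \<nu> ts n (\<sigma>s[i := w])"
    unfolding stirling_perm_seq_def using len stir w(3) i
    by (auto simp: nth_list_update intro!: exI[of _ "Xs[i := Xs ! i - {Suc n}]"])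
  moreover have "(i, p) \<in> gaps (\<sigma>s[i := w])"
    using i len w(2) by (simp add: gaps_def)
  moreover have "\<sigma>s = insert_block_seq \<nu> (Suc n) (i, p) (\<sigma>s[i := w])"
    using i len w(1) by (simp add: insert_block_seq_def) (metis list_update_id)
  ultimately show "\<sigma>s \<in> (\<lambda>(\<rho>s, g). insert_block_seq \<nu> (Suc n) g \<rho>s) `
      (SIGMA \<rho>s:stirling_perm_seqs \<nu> ts n. gaps \<rho>s)"
    by force
next
  fix \<sigma>s assume "\<sigma>s \<in> (\<lambda>(\<rho>s, g). insert_block_seq \<nu> (Suc n) g \<rho>s) `
      (SIGMA \<rho>s:stirling_perm_seqs \<nu> ts n. gaps \<rho>s)"
  then obtain \<rho>s i p where \<sigma>s: "\<sigma>s = insert_block_seq \<nu> (Suc n) (i, p) \<rho>s"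
    and \<rho>s: "stirling_perm_seq \<nu> ts n \<rho>s" and ip: "i < length \<rho>s"
    by (auto simp: gaps_def)
  from \<rho>s obtain Xs where len: "length \<rho>s = length ts" "length Xs = length ts"
    and part: "ordered_partition Xs {1..n}"
    and stir: "\<And>i. i < length ts \<Longrightarrow> stirling_perm \<nu> (ts ! i) (Xs ! i) (\<rho>s ! i)"
    unfolding stirling_perm_seq_def by auto
  have X: "Xs ! i \<subseteq> {1..n}"
    using part ip len unfolding ordered_partition_iff by simp
  then have "finite (Xs ! i)" "\<forall>x \<in> Xs ! i. x < Suc n"
    by (auto intro: finite_subset)
  then have new: "stirling_perm \<nu> (ts ! i) (insert (Suc n) (Xs ! i)) (insert_block \<nu> (Suc n) p (\<rho>s ! i))"
    using stir ip len by (simp add: stirling_perm_insert_block)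
  have "ordered_partition (Xs[i := insert (Suc n) (Xs ! i)]) (insert (Suc n) {1..n})"
    using part ip len by (simp add: ordered_partition_insert)
  moreover have "insert (Suc n) {1..n} = {1..Suc n}"
    by auto
  ultimately have "stirling_perm_seq \<nu> ts (Suc n) \<sigma>s"
    unfolding stirling_perm_seq_def \<sigma>s insert_block_seq_def using len stir new ip
    by (auto simp: nth_list_update intro!: exI[of _ "Xs[i := insert (Suc n) (Xs ! i)]"])
  then show "\<sigma>s \<in> stirling_perm_seqs \<nu> ts (Suc n)"
    by simp
qed

lemma finite_stirling_perm_seqs: "finite (stirling_perm_seqs \<nu> ts n)"
proof (induction n)
  case (Suc n)
  have "finite (gaps \<rho>s)" for \<rho>s
    by (simp add: gaps_def)
  then show ?case
    unfolding stirling_perm_seqs_Suc using Suc by blast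
qed (simp add: stirling_perm_seqs_0)

lemma stirling_perm_seq_letters_le:
  assumes "stirling_perm_seq \<nu> ts n \<rho>s" "i < length \<rho>s" "x \<in> set (\<rho>s ! i)"
  shows "x \<le> n"
proof -
  obtain Xs where Xs: "length Xs = length ts" "ordered_partition Xs {1..n}"
      "stirling_perm \<nu> (ts ! i) (Xs ! i) (\<rho>s ! i)" and i: "i < length ts"
    using assms(1,2) unfolding stirling_perm_seq_def by auto
  then have X: "Xs ! i \<subseteq> {1..n}"
    unfolding ordered_partition_iff by simp
  then have "finite (Xs ! i)"
    by (rule finite_subset) simp
  then show ?thesis
    using stirling_perm_set[OF Xs(3)] assms(3) X by auto
qed

lemma stirling_perm_seq_total_length:
  "stirling_perm_seq \<nu> ts n \<rho>s \<Longrightarrow> sum_list (map length \<rho>s) = \<nu> * n + sum_list ts"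
proof (induction n arbitrary: \<rho>s)
  case 0
  then have "\<rho>s = map (\<lambda>t. replicate t 0) ts"
    using stirling_perm_seqs_0 by blast
  then show ?case
    by (simp add: comp_def)
next
  case (Suc n)
  then have "\<rho>s \<in> stirling_perm_seqs \<nu> ts (Suc n)"
    by simp
  then obtain \<sigma>s i p where \<rho>s: "\<rho>s = insert_block_seq \<nu> (Suc n) (i, p) \<sigma>s"
    and \<sigma>s: "stirling_perm_seq \<nu> ts n \<sigma>s" and ip: "(i, p) \<in> gaps \<sigma>s"
    unfolding stirling_perm_seqs_Suc by auto
  have i: "i < length \<sigma>s"
    using ip by (simp add: gaps_def)
  have "length (\<sigma>s ! i) \<le> sum_list (map length \<sigma>s)"
    using i elem_le_sum_list[of i "map length \<sigma>s"] by simp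
  then have "sum_list (map length \<rho>s) = sum_list (map length \<sigma>s) + \<nu>"
    using i by (simp add: \<rho>s insert_block_seq_def map_update sum_list_update length_insert_block)
  then show ?case
    using Suc.IH[OF \<sigma>s] by simp
qed

text \<open>The gap can be recovered because the inserted letter is new: deleting it gives back the
  sequence, and the first place where it occurs is the gap. For \<open>\<nu> = 0\<close> nothing would be inserted
  and the gap would be lost.\<close>

lemma inj_on_insert_block_seq:
  assumes "\<nu> \<ge> 1" and new: "\<And>\<rho>s i. \<rho>s \<in> R \<Longrightarrow> i < length \<rho>s \<Longrightarrow> m \<notin> set (\<rho>s ! i)"
  shows "inj_on (\<lambda>(\<rho>s, g). insert_block_seq \<nu> m g \<rho>s) (SIGMA \<rho>s:R. gaps \<rho>s)"
proof -
  have recover: "\<rho>s = map (filter (\<lambda>x. x \<noteq> m)) \<tau>s"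
      "j < length \<rho>s \<Longrightarrow> m \<in> set (\<tau>s ! j) \<longleftrightarrow> j = i"
      "p = length (takeWhile (\<lambda>x. x \<noteq> m) (\<tau>s ! i))"
    if "\<tau>s = insert_block_seq \<nu> m (i, p) \<rho>s" "\<rho>s \<in> R" "i < length \<rho>s" "p \<le> length (\<rho>s ! i)"
    for \<tau>s \<rho>s i j p
  proof -
    have nth: "\<tau>s ! j = (if j = i then insert_block \<nu> m p (\<rho>s ! i) else \<rho>s ! j)"
      if "j < length \<rho>s" for j
      using that \<open>\<tau>s = _\<close> by (simp add: insert_block_seq_def nth_list_update)
    have len: "length \<tau>s = length \<rho>s"
      using that by (simp add: insert_block_seq_def)
    show "\<rho>s = map (filter (\<lambda>x. x \<noteq> m)) \<tau>s"
    proof (rule nth_equalityI)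
      fix j assume j: "j < length \<rho>s"
      have "filter (\<lambda>x. x \<noteq> m) (\<rho>s ! j) = \<rho>s ! j"
        using new[OF that(2) j] by (auto intro: filter_True)
      then show "\<rho>s ! j = map (filter (\<lambda>x. x \<noteq> m)) \<tau>s ! j"
        using j len new[OF that(2) j] by (auto simp: nth filter_insert_block)
    qed (simp add: len)
    show "m \<in> set (\<tau>s ! j) \<longleftrightarrow> j = i" if "j < length \<rho>s"
      using that new[OF \<open>\<rho>s \<in> R\<close> that] assms(1) by (simp add: nth insert_block_def)
    show "p = length (takeWhile (\<lambda>x. x \<noteq> m) (\<tau>s ! i))"
      using that(3,4) new[OF that(2,3)] assms(1) nth[OF that(3)]
      by (simp add: takeWhile_insert_block)
  qed
  show ?thesis
  proof (rule inj_onI)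
    fix q q'
    assume q: "q \<in> (SIGMA \<rho>s:R. gaps \<rho>s)" "q' \<in> (SIGMA \<rho>s:R. gaps \<rho>s)"
      and ins: "(\<lambda>(\<rho>s, g). insert_block_seq \<nu> m g \<rho>s) q = (\<lambda>(\<rho>s, g). insert_block_seq \<nu> m g \<rho>s) q'"
    obtain \<rho>s i p \<rho>s' i' p' where qs: "q = (\<rho>s, i, p)" "q' = (\<rho>s', i', p')"
      by (metis surj_pair)
    have eq: "insert_block_seq \<nu> m (i, p) \<rho>s = insert_block_seq \<nu> m (i', p') \<rho>s'"
      and R: "\<rho>s \<in> R" "\<rho>s' \<in> R" and gaps: "(i, p) \<in> gaps \<rho>s" "(i', p') \<in> gaps \<rho>s'"
      using q ins by (auto simp: qs)
    have g: "i < length \<rho>s" "p \<le> length (\<rho>s ! i)" "i' < length \<rho>s'" "p' \<le> length (\<rho>s' ! i')"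
      using gaps by (auto simp: gaps_def)
    note r = recover[OF refl R(1) g(1,2)] and r' = recover[OF eq R(2) g(3,4)]
    have \<rho>s: "\<rho>s = \<rho>s'"
      using r(1) r'(1) by metis
    moreover have i: "i = i'"
      using r(2)[OF g(1)] r'(2)[of i] g(1) \<rho>s by simp
    moreover have "p = p'"
      using r(3) r'(3) i by simp
    ultimately show "q = q'"
      by (simp add: qs)
  qed
qed

section \<open>The effect of an insertion on ascents\<close>

lemma finite_ascents:
  fixes w :: "nat list"
  shows "finite {i. Suc i < length w \<and> w ! i < w ! Suc i}"
  by (rule finite_subset[of _ "{..<length w}"]) auto

lemma ascents_Nil [simp]: "ascents [] = 0"
  by (simp add: ascents_def)

lemma ascents_Cons:
  "ascents (x # w) = (if w \<noteq> [] \<and> x < hd w then 1 else 0) + ascents w"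
proof -
  have split: "{i. Suc i < length (x # w) \<and> (x # w) ! i < (x # w) ! Suc i}
      = {i. i = 0 \<and> w \<noteq> [] \<and> x < hd w} \<union> Suc ` {i. Suc i < length w \<and> w ! i < w ! Suc i}"
    (is "?L = ?A \<union> Suc ` ?B")
  proof (rule set_eqI)
    fix i show "i \<in> ?L \<longleftrightarrow> i \<in> ?A \<union> Suc ` ?B"
      by (cases i) (auto simp: hd_conv_nth)
  qed
  have fin: "finite ?A" "finite ?B"
    using finite_ascents by auto
  have "card ?L = card ?A + card (Suc ` ?B)"
    unfolding split using fin by (intro card_Un_disjoint) auto
  moreover have "card (Suc ` ?B) = card ?B"
    by (intro card_image) simp
  moreover have "card ?A = (if w \<noteq> [] \<and> x < hd w then 1 else 0)"
    by auto
  ultimately show ?thesis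
    by (simp add: ascents_def)
qed

lemma ascents_append:
  "ascents (u @ v) = ascents u + (if u \<noteq> [] \<and> v \<noteq> [] \<and> last u < hd v then 1 else 0) + ascents v"
  by (induction u) (auto simp: ascents_Cons)

lemma ascents_replicate [simp]: "ascents (replicate k x) = 0"
  by (induction k) (auto simp: ascents_Cons)

text \<open>Neutral refers to a block of letters larger than those of \<open>w\<close>: these are exactly the
  positions where inserting it leaves the number of ascents unchanged.\<close>

definition neutral_positions :: "nat list \<Rightarrow> nat set" where
  "neutral_positions w = {p. p = 0 \<or> p < length w \<and> w ! (p - 1) < w ! p}"

lemma neutral_positions_eq:
  "neutral_positions w = insert 0 (Suc ` {i. Suc i < length w \<and> w ! i < w ! Suc i})"
proof (rule set_eqI)
  fix p show "p \<in> neutral_positions w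
      \<longleftrightarrow> p \<in> insert 0 (Suc ` {i. Suc i < length w \<and> w ! i < w ! Suc i})"
    by (cases p) (auto simp: neutral_positions_def)
qed

lemma neutral_positions_subset: "neutral_positions w \<subseteq> {..length w}"
  by (auto simp: neutral_positions_def)

lemma card_neutral_positions: "card (neutral_positions w) = ascents w + 1"
proof -
  let ?A = "{i. Suc i < length w \<and> w ! i < w ! Suc i}"
  have "card (neutral_positions w) = Suc (card (Suc ` ?A))"
    unfolding neutral_positions_eq
    by (intro card_insert_disjoint finite_imageI finite_ascents) auto
  also have "card (Suc ` ?A) = card ?A"
    by (intro card_image) simp
  finally show ?thesis
    by (simp add: ascents_def)
qed

text \<open>The block creates an ascent on its left unless it is at the front, and no ascent inside or on
  its right; an ascent of \<open>w\<close> across the gap is destroyed.\<close>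

lemma ascents_insert_block:
  assumes "\<nu> \<ge> 1" "\<forall>x \<in> set w. x < m" "p \<le> length w"
  shows "ascents (insert_block \<nu> m p w) = ascents w + (if p \<in> neutral_positions w then 0 else 1)"
proof -
  define u v where "u = take p w" and "v = drop p w"
  have w: "w = u @ v" and p: "p = length u"
    using assms(3) by (simp_all add: u_def v_def)
  have "last u < m" if "u \<noteq> []"
    using that assms(2) by (simp add: w)
  moreover have "\<not> m < hd v" if "v \<noteq> []"
    using that assms(2) by (metis UnCI hd_in_set order_less_asym set_append w)
  moreover have "p \<in> neutral_positions w \<longleftrightarrow> u = [] \<or> v \<noteq> [] \<and> last u < hd v"
    unfolding neutral_positions_def
    by (cases "u = []") (auto simp: w p nth_append last_conv_nth hd_conv_nth)
  moreover have "replicate \<nu> m \<noteq> []" "hd (replicate \<nu> m) = m" "last (replicate \<nu> m) = m"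
    using assms(1) by (auto simp: hd_replicate)
  ultimately show ?thesis
    unfolding insert_block_def u_def[symmetric] v_def[symmetric]
    by (auto simp: w ascents_append)
qed

definition neutral_gaps :: "nat list list \<Rightarrow> (nat \<times> nat) set" where
  "neutral_gaps \<rho>s = (SIGMA i:{..<length \<rho>s}. neutral_positions (\<rho>s ! i))"

lemma neutral_gaps_subset: "neutral_gaps \<rho>s \<subseteq> gaps \<rho>s"
  using neutral_positions_subset by (fastforce simp: neutral_gaps_def gaps_def)

lemma card_gaps: "card (gaps \<rho>s) = sum_list (map length \<rho>s) + length \<rho>s"
  by (simp add: gaps_def sum_list_sum_nth atLeast0LessThan sum_Suc)

lemma card_neutral_gaps: "card (neutral_gaps \<rho>s) = ascents_seq \<rho>s + length \<rho>s"
proof -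
  have "card (neutral_gaps \<rho>s) = (\<Sum>i<length \<rho>s. card (neutral_positions (\<rho>s ! i)))"
    unfolding neutral_gaps_def
    using finite_subset[OF neutral_positions_subset] by (intro card_SigmaI) auto
  also have "\<dots> = (\<Sum>i<length \<rho>s. ascents (\<rho>s ! i)) + length \<rho>s"
    by (simp add: card_neutral_positions sum_Suc)
  also have "\<dots> = ascents_seq \<rho>s + length \<rho>s"
    by (simp add: ascents_seq_def sum_list_sum_nth atLeast0LessThan)
  finally show ?thesis .
qed

lemma ascents_seq_insert_block_seq:
  assumes "\<nu> \<ge> 1" "g \<in> gaps \<rho>s" "\<And>i x. i < length \<rho>s \<Longrightarrow> x \<in> set (\<rho>s ! i) \<Longrightarrow> x < m"
  shows "ascents_seq (insert_block_seq \<nu> m g \<rho>s)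
      = ascents_seq \<rho>s + (if g \<in> neutral_gaps \<rho>s then 0 else 1)"
proof -
  obtain i p where g: "g = (i, p)" and ip: "i < length \<rho>s" "p \<le> length (\<rho>s ! i)"
    using assms(2) by (auto simp: gaps_def)
  have "ascents (insert_block \<nu> m p (\<rho>s ! i))
      = ascents (\<rho>s ! i) + (if g \<in> neutral_gaps \<rho>s then 0 else 1)"
    using ascents_insert_block[of \<nu> "\<rho>s ! i" m p] assms(1,3) ip by (simp add: g neutral_gaps_def)
  moreover have "ascents (\<rho>s ! i) \<le> sum_list (map ascents \<rho>s)"
    using ip elem_le_sum_list[of i "map ascents \<rho>s"] by simp
  ultimately show ?thesis
    using ip by (simp add: ascents_seq_def insert_block_seq_def g map_update sum_list_update)
qed

section \<open>The recurrence\<close>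

text \<open>For \<open>k = 0\<close> there is no sequence with one ascent fewer, and the second set below is empty.
  Describing it by \<open>Suc (ascents_seq \<rho>s) = k\<close> covers this case without a truncated \<open>k - 1\<close>. The
  integer \<open>\<nu> * n + t + 1 - k\<close> can be negative only when that set is empty, for it is
  the number of its members' gaps that are not neutral.\<close>

lemma card_stirling_perm_seqs_Suc:
  assumes "\<nu> \<ge> 1"
  shows "int (card {\<rho>s. stirling_perm_seq \<nu> ts (Suc n) \<rho>s \<and> ascents_seq \<rho>s = k})
    = (int k + int (length ts))
        * int (card {\<rho>s. stirling_perm_seq \<nu> ts n \<rho>s \<and> ascents_seq \<rho>s = k})
      + (int \<nu> * int n + int (sum_list ts) + 1 - int k)
        * int (card {\<rho>s. stirling_perm_seq \<nu> ts n \<rho>s \<and> Suc (ascents_seq \<rho>s) = k})"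
    (is "int (card ?C) = _ * int (card ?A) + _ * int (card ?B)")
proof -
  let ?ins = "\<lambda>(\<rho>s, g). insert_block_seq \<nu> (Suc n) g \<rho>s"
  define P where "P = (SIGMA \<rho>s:?A. neutral_gaps \<rho>s)"
  define Q where "Q = (SIGMA \<rho>s:?B. gaps \<rho>s - neutral_gaps \<rho>s)"
  have small: "x < Suc n"
    if "stirling_perm_seq \<nu> ts n \<rho>s" "i < length \<rho>s" "x \<in> set (\<rho>s ! i)" for \<rho>s i x
    using stirling_perm_seq_letters_le[OF that] by simp
  have asc: "ascents_seq (insert_block_seq \<nu> (Suc n) g \<rho>s)
      = ascents_seq \<rho>s + (if g \<in> neutral_gaps \<rho>s then 0 else 1)"
    if "stirling_perm_seq \<nu> ts n \<rho>s" "g \<in> gaps \<rho>s" for \<rho>s g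
    using that assms small by (intro ascents_seq_insert_block_seq) auto
  \<comment> \<open>A sequence with \<open>k\<close> ascents arises from one with \<open>k\<close> ascents at a neutral gap, or from one
    with \<open>k - 1\<close> ascents at any other gap.\<close>
  have "?C = ?ins ` {q \<in> (SIGMA \<rho>s:stirling_perm_seqs \<nu> ts n. gaps \<rho>s). ascents_seq (?ins q) = k}"
    using stirling_perm_seqs_Suc[of \<nu> ts n] by (auto simp: set_eq_iff image_iff)
  also have "{q \<in> (SIGMA \<rho>s:stirling_perm_seqs \<nu> ts n. gaps \<rho>s). ascents_seq (?ins q) = k} = P \<union> Q"
    using neutral_gaps_subset by (fastforce simp: P_def Q_def asc split: if_splits)
  finally have C: "?C = ?ins ` (P \<union> Q)" .
  have sub: "P \<union> Q \<subseteq> (SIGMA \<rho>s:stirling_perm_seqs \<nu> ts n. gaps \<rho>s)"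
    using neutral_gaps_subset by (fastforce simp: P_def Q_def)
  have "inj_on ?ins (SIGMA \<rho>s:stirling_perm_seqs \<nu> ts n. gaps \<rho>s)"
    using assms small by (intro inj_on_insert_block_seq) auto
  then have card_C: "card ?C = card (P \<union> Q)"
    unfolding C using sub by (intro card_image) (rule inj_on_subset)
  have fin_gaps: "finite (gaps \<rho>s)" for \<rho>s
    by (simp add: gaps_def)
  have fin_neutral: "finite (neutral_gaps \<rho>s)" for \<rho>s
    using neutral_gaps_subset fin_gaps by (rule finite_subset)
  have fin: "finite ?A" "finite ?B"
    using finite_stirling_perm_seqs[of \<nu> ts n] by auto
  have len: "length \<rho>s = length ts" if "stirling_perm_seq \<nu> ts n \<rho>s" for \<rho>s
    using that by (simp add: stirling_perm_seq_def)
  have "finite P" "finite Q" "P \<inter> Q = {}"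
    using fin fin_gaps fin_neutral by (auto simp: P_def Q_def)
  then have card_PQ: "card (P \<union> Q) = card P + card Q"
    by (rule card_Un_disjoint)
  have "card P = (\<Sum>\<rho>s\<in>?A. card (neutral_gaps \<rho>s))"
    unfolding P_def using fin fin_neutral by (intro card_SigmaI) auto
  also have "\<dots> = (\<Sum>\<rho>s\<in>?A. k + length ts)"
    by (intro sum.cong) (auto simp: card_neutral_gaps len)
  finally have card_P: "int (card P) = (int k + int (length ts)) * int (card ?A)"
    by simp
  have "card Q = (\<Sum>\<rho>s\<in>?B. card (gaps \<rho>s - neutral_gaps \<rho>s))"
    unfolding Q_def using fin fin_gaps by (intro card_SigmaI) auto
  then have "int (card Q) = (\<Sum>\<rho>s\<in>?B. int (card (gaps \<rho>s - neutral_gaps \<rho>s)))"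
    by simp
  also have "\<dots> = (\<Sum>\<rho>s\<in>?B. int \<nu> * int n + int (sum_list ts) + 1 - int k)"
  proof (intro sum.cong refl)
    fix \<rho>s assume "\<rho>s \<in> ?B"
    then have \<rho>s: "stirling_perm_seq \<nu> ts n \<rho>s" "Suc (ascents_seq \<rho>s) = k"
      by auto
    have "card (neutral_gaps \<rho>s) \<le> card (gaps \<rho>s)"
      using neutral_gaps_subset fin_gaps by (intro card_mono)
    then have "int (card (gaps \<rho>s - neutral_gaps \<rho>s))
        = int (card (gaps \<rho>s)) - int (card (neutral_gaps \<rho>s))"
      using neutral_gaps_subset fin_neutral by (simp add: card_Diff_subset)
    then show "int (card (gaps \<rho>s - neutral_gaps \<rho>s))
        = int \<nu> * int n + int (sum_list ts) + 1 - int k"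
      using \<rho>s(2) by (simp add: card_gaps card_neutral_gaps stirling_perm_seq_total_length[OF \<rho>s(1)]
          flip: \<rho>s(2))
  qed
  finally have card_Q: "int (card Q)
      = (int \<nu> * int n + int (sum_list ts) + 1 - int k) * int (card ?B)"
    by simp
  show ?thesis
    using card_C card_PQ card_P card_Q by simp
qed

theorem theorem6:
  fixes \<nu> s t n k :: nat and ts :: "nat list"
  assumes "\<nu> \<ge> 1" and "s \<ge> 1"
    and "length ts = s" and "sum_list ts = t"
  shows "int (card {\<rho>s. stirling_perm_seq \<nu> ts n \<rho>s \<and> ascents_seq \<rho>s = k})
           = eulerian \<nu> s t (int n) (int k)"
proof (induction n arbitrary: k)
  case 0
  have "ascents_seq (map (\<lambda>t. replicate t 0) ts) = 0"
    by (simp add: ascents_seq_def comp_def)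
  moreover have "stirling_perm_seq \<nu> ts 0 \<rho>s \<longleftrightarrow> \<rho>s = map (\<lambda>t. replicate t 0) ts" for \<rho>s
    using stirling_perm_seqs_0[of \<nu> ts] by blast
  ultimately have "{\<rho>s. stirling_perm_seq \<nu> ts 0 \<rho>s \<and> ascents_seq \<rho>s = k}
      = (if k = 0 then {map (\<lambda>t. replicate t 0) ts} else {})"
    by auto
  moreover have "eulerian \<nu> s t (- 1) j = 0" for j
    by (simp add: eulerian.simps)
  ultimately show ?case
    by (simp add: eulerian.simps[of \<nu> s t 0])
next
  case (Suc n)
  have "int (card {\<rho>s. stirling_perm_seq \<nu> ts n \<rho>s \<and> Suc (ascents_seq \<rho>s) = k})
      = eulerian \<nu> s t (int n) (int k - 1)"
  proof (cases k)
    case 0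
    then show ?thesis
      by (simp add: eulerian.simps)
  next
    case (Suc j)
    then show ?thesis
      using Suc.IH[of j] by simp
  qed
  then show ?case
    using assms card_stirling_perm_seqs_Suc[OF assms(1), of ts n k] Suc.IH[of k]
    by (subst eulerian.simps) (simp add: algebra_simps)
qed

end
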